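(* Let $\hat{\mathbf h}$ be the logit-based stochastic user equilibrium path flow, i.e. the feasible path flow vector with $\hat{\mathbf h}=\mathcal{L}(\hat{\mathbf h})$, and let $\mathcal{F}(\mathbf h)=\mathcal{L}(\mathbf h)-\mathbf h$. Consider the inexact Newton method $\mathbf h^{k+1}=\mathbf h^k+\boldsymbol\delta^k$, where $\boldsymbol\delta^k$ is obtained by applying GMRES, initialized at $\mathbf 0$, to $(\mathbf I-\mathcal{K}(\mathbf h^k))\boldsymbol\delta=\mathcal{F}(\mathbf h^k)$ and stopping at the first iterate with $$\bigl\|(\mathbf I-\mathcal{K}(\mathbf h^k))\boldsymbol\delta^k-\mathcal{F}(\mathbf h^k)\bigr\|\le\eta_k\,\|\mathcal{F}(\mathbf h^k)\|,$$ with relative tolerance $$\eta_k=\min\bigl(\eta_{\mathrm{tol}},\ \nu_2\,\|\mathcal{F}(\mathbf h^k)\|\bigr),$$ where $0<\eta_{\mathrm{tol}}<1$ and $\nu_2>0$. Then the inexact Newton method converges locally quadratically: there is a neighborhood of $\hat{\mathbf h}$ such that, for every feasible starting point $\mathbf h^0$ in it, $\mathbf h^k\to\hat{\mathbf h}$ and there is $C>0$ with $\|\mathbf h^{k+1}-\hat{\mathbf h}\|\le C\|\mathbf h^k-\hat{\mathbf h}\|^2$ for all $k$.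
   Context: Network setting. There is a finite set $\mathbb{L}$ of links and a finite nonempty set of origin-destination (OD) pairs. Each OD pair has a demand $d_{OD}\ge 0$ and a fixed finite nonempty set $\mathbb{P}_{OD}$ of acyclic paths; $\mathbb{P}$ is the disjoint union of the $\mathbb{P}_{OD}$, $n=|\mathbb{P}|$, and $OD(i)$ is the OD pair of path $i$. $\mathbf{D}\in\{0,1\}^{|\mathbb{L}|\times n}$ is the link-path incidence matrix ($D_{li}=1$ iff link $l$ is on path $i$). A vector $\mathbf{h}\in\mathbb{R}^n$ is a feasible path flow vector if $h_i\ge 0$ for all $i$ and $\sum_{i\in\mathbb{P}_{OD}}h_i=d_{OD}$ for every OD pair. Costs. The cost of link $l$ depends only on its own flow $a_l$ via $\tau_l:[0,\infty)\to[0,\infty)$, which is twice continuously differentiable and monotone non-decreasing, with $\tau_l'$ Lipschitz on the bounded set of link flows arising from feasible path flows. Link flows are $\mathbf a=\mathbf D\mathbf h$, path costs are $\mathcal{C}(\mathbf h)=\mathbf{D}^T\mathcal{T}(\mathbf{D}\mathbf{h})$ with $\mathcal{T}_l(\mathbf a)=\tau_l(a_l)$, and the Jacobian is $\mathcal{C}'(\mathbf h)=\mathbf D^T\operatorname{diag}(\tau_l'(a_l))\mathbf D$. Logit model. $\theta>0$ is a fixed parameter. For a path cost vector $\mathbf c$, $\mathcal{P}(\mathbf c)_i=\exp(-\theta c_i)/\sum_{i'\in\mathbb{P}_{OD(i)}}\exp(-\theta c_{i'})$. Put $\mathcal{H}(\mathbf h,\mathbf p)_i=\bigl(\sum_{i'\in\mathbb{P}_{OD(i)}}h_{i'}\bigr)p_i$.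 The logit mapping is $\mathcal{L}(\mathbf h)=\mathcal{H}(\mathbf h,\mathcal{P}(\mathcal{C}(\mathbf h)))$. $\mathcal{P}'(\mathbf c)$ is the Jacobian of $\mathcal{P}$, and $\mathcal{H}'_{\mathbf p}(\mathbf h)$ is the Jacobian of $\mathcal{H}$ in $\mathbf p$ with $\mathbf h$ fixed (for feasible $\mathbf h$, the diagonal matrix with entries $d_{OD(i)}$). The reduced Jacobian is $\mathcal{K}(\mathbf h)=\mathcal{H}'_{\mathbf p}(\mathbf h)\,\mathcal{P}'(\mathbf c)\,\mathcal{C}'(\mathbf h)$ with $\mathbf c=\mathcal{C}(\mathbf h)$; for feasible $\mathbf h$ its eigenvalues are real and non-positive, so $\mathbf I-\mathcal{K}(\mathbf h)$ is invertible. GMRES. For a system $\mathbf A\boldsymbol\delta=\mathbf r$ and initialization at $\mathbf 0$, the $b$-th GMRES iterate ($b\ge1$) is the vector minimizing $\|\mathbf r-\mathbf A\boldsymbol\delta\|$ over $\boldsymbol\delta\in\mathrm{span}\{\mathbf r,\mathbf A\mathbf r,\dots,\mathbf A^{b-1}\mathbf r\}$ (if $\mathbf r=\mathbf 0$ the output is $\mathbf 0$). It is known (Fisk) that the feasible fixed point $\hat{\mathbf h}$ of $\mathcal{L}$ exists and is unique. $\|\cdot\|$ is the $\ell_2$ norm. *)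

theory Defs
  imports "HOL-Analysis.Analysis" "Graph_Theory.Arc_Walk"
begin

text \<open>
  The links are the elements of the finite type \<open>'l\<close>, the OD pairs those of \<open>'o\<close> and the
  paths (the disjoint union of the path sets of the OD pairs) those of \<open>'p\<close>, so that path
  vectors are elements of \<open>real ^ 'p\<close> and link vectors are elements of \<open>real ^ 'l\<close>.
\<close>

record ('v, 'l, 'o, 'p) network =
  graph :: "('v, 'l) pre_digraph"
  origin :: "'o \<Rightarrow> 'v"
  destination :: "'o \<Rightarrow> 'v"
  demand :: "'o \<Rightarrow> real"
  od :: "'p \<Rightarrow> 'o"
  path_links :: "'p \<Rightarrow> 'l list"
  link_cost :: "'l \<Rightarrow> real \<Rightarrow> real"

definition paths_of :: "('v, 'l, 'o, 'p) network \<Rightarrow> 'o \<Rightarrow> 'p set" where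
  "paths_of N w = {i. od N i = w}"

definition feasible :: "('v, 'l, 'o, 'p::finite) network \<Rightarrow> real ^ 'p \<Rightarrow> bool" where
  "feasible N h \<longleftrightarrow>
     (\<forall>i. h $ i \<ge> 0) \<and> (\<forall>w. (\<Sum>i\<in>paths_of N w. h $ i) = demand N w)"

definition incidence :: "('v, 'l::finite, 'o, 'p::finite) network \<Rightarrow> real ^ 'p ^ 'l" where
  "incidence N = (\<chi> l i. if l \<in> set (path_links N i) then 1 else 0)"

definition link_flow :: "('v, 'l::finite, 'o, 'p::finite) network \<Rightarrow> real ^ 'p \<Rightarrow> real ^ 'l" where
  "link_flow N h = incidence N *v h"

text \<open>
  Link costs matter on \<open>{0..}\<close> only; their derivative is taken within that set, hence is
  one-sided at 0.
\<close>

definition link_cost_deriv :: "('v, 'l, 'o, 'p) network \<Rightarrow> 'l \<Rightarrow> real \<Rightarrow> real" where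
  "link_cost_deriv N l a = vector_derivative (link_cost N l) (at a within {0..})"

definition logit_network :: "('v, 'l::finite, 'o::finite, 'p::finite) network \<Rightarrow> bool" where
  "logit_network N \<longleftrightarrow>
     wf_digraph (graph N) \<and> arcs (graph N) = UNIV \<and>
     (\<forall>i. pre_digraph.apath (graph N) (origin N (od N i)) (path_links N i)
            (destination N (od N i))) \<and>
     inj (\<lambda>i. (od N i, path_links N i)) \<and>
     (\<forall>w. paths_of N w \<noteq> {}) \<and>
     (\<forall>w. demand N w \<ge> 0) \<and>
     (\<forall>l. (\<forall>a\<ge>0. link_cost N l a \<ge> 0) \<and>
          mono_on {0..} (link_cost N l) \<and>
          (\<forall>a\<ge>0. (link_cost N l has_real_derivative link_cost_deriv N l a) (at a within {0..})) \<and>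
          (\<exists>d2. (\<forall>a\<ge>0. (link_cost_deriv N l has_real_derivative d2 a) (at a within {0..})) \<and>
                continuous_on {0..} d2) \<and>
          (\<exists>B. B-lipschitz_on {link_flow N h $ l | h. feasible N h} (link_cost_deriv N l)))"

definition path_cost :: "('v, 'l::finite, 'o, 'p::finite) network \<Rightarrow> real ^ 'p \<Rightarrow> real ^ 'p" where
  "path_cost N h =
     transpose (incidence N) *v (\<chi> l. link_cost N l (link_flow N h $ l))"

definition diag_matrix :: "real ^ 'n \<Rightarrow> real ^ 'n ^ 'n" where
  "diag_matrix v = (\<chi> i j. if i = j then v $ i else 0)"

definition path_cost_jacobian ::
    "('v, 'l::finite, 'o, 'p::finite) network \<Rightarrow> real ^ 'p \<Rightarrow> real ^ 'p ^ 'p" where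
  "path_cost_jacobian N h =
     transpose (incidence N) **
     diag_matrix (\<chi> l. link_cost_deriv N l (link_flow N h $ l)) ** incidence N"

definition choice_prob ::
    "('v, 'l, 'o, 'p::finite) network \<Rightarrow> real \<Rightarrow> real ^ 'p \<Rightarrow> real ^ 'p" where
  "choice_prob N \<theta> c =
     (\<chi> i. exp (- \<theta> * c $ i) / (\<Sum>j\<in>paths_of N (od N i). exp (- \<theta> * c $ j)))"

definition assign ::
    "('v, 'l, 'o, 'p::finite) network \<Rightarrow> real ^ 'p \<Rightarrow> real ^ 'p \<Rightarrow> real ^ 'p" where
  "assign N h p = (\<chi> i. (\<Sum>j\<in>paths_of N (od N i). h $ j) * p $ i)"

definition logit_map ::
    "('v, 'l::finite, 'o, 'p::finite) network \<Rightarrow> real \<Rightarrow> real ^ 'p \<Rightarrow> real ^ 'p" where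
  "logit_map N \<theta> h = assign N h (choice_prob N \<theta> (path_cost N h))"

definition logit_residual ::
    "('v, 'l::finite, 'o, 'p::finite) network \<Rightarrow> real \<Rightarrow> real ^ 'p \<Rightarrow> real ^ 'p" where
  "logit_residual N \<theta> h = logit_map N \<theta> h - h"

definition reduced_jacobian ::
    "('v, 'l::finite, 'o, 'p::finite) network \<Rightarrow> real \<Rightarrow> real ^ 'p \<Rightarrow> real ^ 'p ^ 'p" where
  "reduced_jacobian N \<theta> h =
     (let c = path_cost N h
      in jacobian (assign N h) (at (choice_prob N \<theta> c)) **
         jacobian (choice_prob N \<theta>) (at c) **
         path_cost_jacobian N h)"

text \<open>
  Powers of a matrix are iterates of \<open>(*v) A\<close> here: multiplication, and hence \<open>^\<close>, on
  vector types is componentwise.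
\<close>

definition krylov :: "real ^ 'n ^ 'n \<Rightarrow> real ^ 'n \<Rightarrow> nat \<Rightarrow> (real ^ 'n) set" where
  "krylov A r b = span ((\<lambda>j. ((*v) A ^^ j) r) ` {..<b})"

definition gmres_iterate :: "real ^ 'n ^ 'n \<Rightarrow> real ^ 'n \<Rightarrow> nat \<Rightarrow> real ^ 'n" where
  "gmres_iterate A r b = (ARG_MIN (\<lambda>\<delta>. norm (r - A *v \<delta>)) \<delta>. \<delta> \<in> krylov A r b)"

text \<open>
  For \<open>r = 0\<close> the first Krylov space is \<open>{0}\<close>, so the output below is \<open>0\<close>.
\<close>

definition gmres :: "real ^ 'n ^ 'n \<Rightarrow> real ^ 'n \<Rightarrow> real \<Rightarrow> real ^ 'n" where
  "gmres A r \<eta> = gmres_iterate A r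
     (LEAST b. b \<ge> 1 \<and> norm (A *v gmres_iterate A r b - r) \<le> \<eta> * norm r)"

primrec inexact_newton ::
    "('v, 'l::finite, 'o, 'p::finite) network \<Rightarrow> real \<Rightarrow> real \<Rightarrow> real \<Rightarrow> real ^ 'p \<Rightarrow>
     nat \<Rightarrow> real ^ 'p" where
  "inexact_newton N \<theta> \<eta>tol \<nu> h0 0 = h0"
| "inexact_newton N \<theta> \<eta>tol \<nu> h0 (Suc k) =
     (let h = inexact_newton N \<theta> \<eta>tol \<nu> h0 k;
          r = logit_residual N \<theta> h;
          \<eta> = min \<eta>tol (\<nu> * norm r)
      in h + gmres (mat 1 - reduced_jacobian N \<theta> h) r \<eta>)"

end

theory Submission
  imports Defs
begin

text \<open>
  On the feasible set the logit map is \<open>h \<mapsto> demand \<cdot> P(C(h))\<close>, whose derivative along the set is the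
  reduced Jacobian \<open>K(h)\<close>. The feasible set is bounded and convex and \<open>K\<close> is Lipschitz on it, so
  the Newton linearization has a quadratic remainder. Moreover \<open>- K = B M\<close> with \<open>B\<close>, \<open>M\<close> symmetric
  positive semidefinite (\<open>M\<close> is the Jacobian of the path costs, \<open>B\<close> is a covariance form of the
  choice probabilities), hence \<open>(I - K)\<inverse>\<close> is bounded uniformly over the feasible set. Therefore
  \<open>I - K\<close> is injective, the exact Newton step lies in some Krylov space, GMRES stops, and its
  tolerance contributes an error of order \<open>\<parallel>F(h)\<parallel>\<^sup>2\<close> only. Finally, all Krylov spaces consist of
  vectors with zero sum over each OD pair and zero entries on OD pairs without demand. As the
  equilibrium is positive on all other paths, iterates close to it remain feasible.
\<close>

section \<open>GMRES\<close>

lemma krylov_mono: "b \<le> c \<Longrightarrow> krylov A r b \<subseteq> krylov A r c"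
  unfolding krylov_def by (intro span_mono image_mono) auto

lemma krylov_mult:
  assumes "x \<in> krylov A r b"
  shows "A *v x \<in> krylov A r (Suc b)"
proof -
  have "(*v) A ` (\<lambda>j. ((*v) A ^^ j) r) ` {..<b} \<subseteq> (\<lambda>j. ((*v) A ^^ j) r) ` {..<Suc b}"
  proof clarify
    fix j assume "j < b"
    then show "A *v ((*v) A ^^ j) r \<in> (\<lambda>j. ((*v) A ^^ j) r) ` {..<Suc b}"
      by (intro image_eqI[where x="Suc j"]) auto
  qed
  then have "(*v) A ` krylov A r b \<subseteq> krylov A r (Suc b)"
    unfolding krylov_def linear_span_image[OF matrix_vector_mul_linear, symmetric]
    by (rule span_mono)
  then show ?thesis using assms by blast
qed

lemma krylov_subset_subspace:
  assumes "subspace V" "r \<in> V" "\<And>x. x \<in> V \<Longrightarrow> A *v x \<in> V"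
  shows "krylov A r b \<subseteq> V"
proof -
  have "((*v) A ^^ j) r \<in> V" for j
    by (induction j) (use assms in auto)
  then show ?thesis
    unfolding krylov_def using assms(1) by (intro span_minimal) auto
qed

text \<open>The nested Krylov spaces have as their union a subspace \<open>W\<close> that
  \<open>A\<close> maps into itself. An injective \<open>A\<close> preserves the dimension of
  \<open>W\<close>, so it maps \<open>W\<close> onto \<open>W\<close>, and \<open>r\<close> has a
  preimage there.\<close>

lemma ex_krylov_solution:
  assumes inj: "inj ((*v) A)"
  shows "\<exists>b. \<exists>x\<in>krylov A r b. A *v x = r"
proof -
  define W where "W = (\<Union>b. krylov A r b)"
  have "subspace W"
  proof (rule subspaceI)
    show "0 \<in> W" by (auto simp: W_def krylov_def intro: span_zero)
    show "x + y \<in> W" if xy: "x \<in> W" "y \<in> W" for x y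
    proof -
      from xy obtain b c where "x \<in> krylov A r b" "y \<in> krylov A r c" by (auto simp: W_def)
      then have "x \<in> krylov A r (max b c)" "y \<in> krylov A r (max b c)"
        using krylov_mono[of b "max b c" A r] krylov_mono[of c "max b c" A r] by auto
      then show ?thesis unfolding W_def krylov_def by (blast intro: span_add)
    qed
    show "c *\<^sub>R x \<in> W" if "x \<in> W" for c x
      using that by (auto simp: W_def krylov_def intro: span_scale)
  qed
  moreover have "(*v) A ` W \<subseteq> W"
    using krylov_mult by (fastforce simp: W_def)
  moreover have "dim ((*v) A ` W) = dim W"
    using inj by (intro dim_image_eq matrix_vector_mul_linear) (auto simp: inj_on_def)
  ultimately have "(*v) A ` W = W"
    by (intro subspace_dim_equal linear_subspace_image matrix_vector_mul_linear) auto
  moreover have "r \<in> W"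
  proof -
    have "r \<in> krylov A r 1" unfolding krylov_def by (rule span_base) auto
    then show ?thesis by (auto simp: W_def)
  qed
  ultimately obtain x where "x \<in> W" "A *v x = r" by (metis imageE)
  then show ?thesis by (auto simp: W_def)
qed

text \<open>The vectors \<open>A *v \<delta>\<close> form a subspace, which is closed, so a point of
  it nearest to \<open>r\<close> exists. The later facts about the iterate rest on this property,
  whichever minimizer is chosen.\<close>

lemma gmres_iterate_is_arg_min:
  "is_arg_min (\<lambda>\<delta>. norm (r - A *v \<delta>)) (\<lambda>\<delta>. \<delta> \<in> krylov A r b) (gmres_iterate A r b)"
proof -
  let ?W = "(*v) A ` krylov A r b"
  have "subspace ?W"
    unfolding krylov_def by (intro linear_subspace_image subspace_span matrix_vector_mul_linear)
  then have "closed ?W" "?W \<noteq> {}"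
    by (auto intro: closed_subspace dest: subspace_0)
  then obtain y where "y \<in> ?W" "\<And>z. z \<in> ?W \<Longrightarrow> dist r y \<le> dist r z"
    using distance_attains_inf by blast
  then have "\<exists>x. is_arg_min (\<lambda>\<delta>. norm (r - A *v \<delta>)) (\<lambda>\<delta>. \<delta> \<in> krylov A r b) x"
    by (auto simp: is_arg_min_def dist_norm not_less)
  then show ?thesis
    unfolding gmres_iterate_def arg_min_def by (rule someI_ex)
qed

text \<open>A Krylov space with an exact solution forces residual zero, so the stopping test
  succeeds for some \<open>b\<close> and \<open>LEAST\<close> is attained. This includes
  \<open>\<eta> = 0\<close>, the tolerance at the equilibrium itself.\<close>

lemma gmres_residual_le:
  assumes inj: "inj ((*v) A)" and "\<eta> \<ge> 0"
  shows "norm (A *v gmres A r \<eta> - r) \<le> \<eta> * norm r"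
proof -
  let ?P = "\<lambda>b. b \<ge> 1 \<and> norm (A *v gmres_iterate A r b - r) \<le> \<eta> * norm r"
  obtain b x where x: "x \<in> krylov A r b" "A *v x = r"
    using ex_krylov_solution[OF inj] by blast
  \<comment> \<open>Going up to \<open>Suc b\<close> meets the side condition
    \<open>b \<ge> 1\<close> of the stopping rule.\<close>
  then have "x \<in> krylov A r (Suc b)" using krylov_mono[of b "Suc b"] by auto
  then have "norm (r - A *v gmres_iterate A r (Suc b)) \<le> norm (r - A *v x)"
    using gmres_iterate_is_arg_min[of r A "Suc b"] by (auto simp: is_arg_min_def not_less)
  with x have "A *v gmres_iterate A r (Suc b) = r" by simp
  then have "?P (Suc b)" using \<open>\<eta> \<ge> 0\<close> by simp
  then have "?P (LEAST b. ?P b)" by (rule LeastI)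
  then show ?thesis unfolding gmres_def by blast
qed

text \<open>Every iterate lies in a Krylov space, so the index at which GMRES stops does not matter.
  Used to keep the Newton step among the directions that preserve the OD flows.\<close>

lemma gmres_in_subspace:
  assumes "subspace V" "r \<in> V" "\<And>x. x \<in> V \<Longrightarrow> A *v x \<in> V"
  shows "gmres A r \<eta> \<in> V"
  using krylov_subset_subspace[OF assms] gmres_iterate_is_arg_min
  unfolding gmres_def is_arg_min_def by (meson subsetD)

section \<open>Estimates for matrices and derivatives\<close>

text \<open>
  For \<open>w = B y\<close> and \<open>y = M x\<close> with \<open>B\<close>, \<open>M\<close> symmetric positive semidefinite this bounds the inverse
  of \<open>I + B M\<close>: pairing \<open>x + w = z\<close> with \<open>y\<close> leaves \<open>w \<bullet> y \<le> z \<bullet> y\<close>, and AM-GM does the rest.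
\<close>

lemma norm_le_norm_add_psd_image:
  fixes x w y z :: "'a::real_inner"
  assumes z: "x + w = z" and xy: "0 \<le> x \<bullet> y" and wy: "(norm w)\<^sup>2 \<le> \<beta> * (w \<bullet> y)"
    and y: "norm y \<le> \<mu> * norm x" and "0 \<le> \<beta>" "0 \<le> \<mu>"
  shows "norm x \<le> (\<beta> * \<mu> + 2) * norm z"
proof -
  have "w \<bullet> y \<le> z \<bullet> y" using xy by (simp add: z[symmetric] inner_add_left)
  also have "\<dots> \<le> norm z * norm y" by (rule norm_cauchy_schwarz)
  also have "\<dots> \<le> norm z * (\<mu> * norm x)" by (intro mult_left_mono y norm_ge_zero)
  finally have "\<beta> * (w \<bullet> y) \<le> \<beta> * (norm z * (\<mu> * norm x))"
    using \<open>0 \<le> \<beta>\<close> by (rule mult_left_mono)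
  with wy have "(norm w)\<^sup>2 \<le> (\<beta> * \<mu> * norm z) * norm x" by (simp add: mult_ac)
  also have "\<dots> \<le> ((\<beta> * \<mu> * norm z + norm x) / 2)\<^sup>2"
    using zero_le_power2[of "\<beta> * \<mu> * norm z - norm x"]
    by (simp add: power2_eq_square field_simps)
  finally have "norm w \<le> (\<beta> * \<mu> * norm z + norm x) / 2"
    by (rule power2_le_imp_le) (use assms in auto)
  \<comment> \<open>The half of \<open>norm x\<close> in the bound on \<open>norm w\<close> is
    absorbed on the left; this produces \<open>\<beta> * \<mu> + 2\<close>.\<close>
  moreover have "norm x \<le> norm z + norm w"
    using norm_triangle_ineq4[of z w] by (simp add: z[symmetric])
  ultimately show ?thesis by (simp add: field_simps)
qed

section \<open>Bounded Lipschitz real-valued functions\<close>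

definition bounded_lipschitz_on :: "'a::metric_space set \<Rightarrow> ('a \<Rightarrow> real) \<Rightarrow> bool" where
  "bounded_lipschitz_on S f \<longleftrightarrow> bounded (f ` S) \<and> (\<exists>L. L-lipschitz_on S f)"

lemma bounded_lipschitz_onI:
  assumes "L-lipschitz_on S f" "bounded S"
  shows "bounded_lipschitz_on S f"
proof (cases "S = {}")
  case False
  then obtain a where a: "a \<in> S" by blast
  obtain e where e: "\<And>x. x \<in> S \<Longrightarrow> dist a x \<le> e"
    using assms(2) bounded_any_center[of S a] by auto
  have "dist (f a) (f x) \<le> L * e" if "x \<in> S" for x
    using lipschitz_onD[OF assms(1) a that] e[OF that] lipschitz_on_nonneg[OF assms(1)]
    by (meson mult_left_mono order_trans)
  then have "bounded (f ` S)" unfolding bounded_def by blast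
  then show ?thesis using assms(1) unfolding bounded_lipschitz_on_def by blast
qed (use assms in \<open>auto simp: bounded_lipschitz_on_def\<close>)

lemma bounded_lipschitz_on_cong:
  assumes "\<And>x. x \<in> S \<Longrightarrow> f x = g x"
  shows "bounded_lipschitz_on S f \<longleftrightarrow> bounded_lipschitz_on S g"
  unfolding bounded_lipschitz_on_def using assms by (simp cong: image_cong lipschitz_on_cong)

lemma bounded_lipschitz_on_const: "bounded_lipschitz_on S (\<lambda>_. c)"
  unfolding bounded_lipschitz_on_def
  using lipschitz_on_constant by (auto simp: image_constant_conv)

lemma bounded_lipschitz_on_add:
  assumes "bounded_lipschitz_on S f" "bounded_lipschitz_on S g"
  shows "bounded_lipschitz_on S (\<lambda>x. f x + g x)"
  using assms unfolding bounded_lipschitz_on_def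
  by (auto intro: bounded_plus_comp lipschitz_on_add)

text \<open>Products are the reason for pairing boundedness with the Lipschitz condition: the
  Lipschitz constant of a product involves the suprema of the factors.\<close>

lemma bounded_lipschitz_on_mult:
  assumes "bounded_lipschitz_on S f" "bounded_lipschitz_on S g"
  shows "bounded_lipschitz_on S (\<lambda>x. f x * g x)"
proof -
  from assms obtain F G K L where
    F: "\<And>x. x \<in> S \<Longrightarrow> \<bar>f x\<bar> \<le> F" and G: "\<And>x. x \<in> S \<Longrightarrow> \<bar>g x\<bar> \<le> G"
    and K: "K-lipschitz_on S f" and L: "L-lipschitz_on S g"
    unfolding bounded_lipschitz_on_def bounded_real by (metis imageI)
  have "bounded ((\<lambda>x. f x * g x) ` S)"
    using order_trans[OF abs_ge_zero F]
    by (intro boundedI[of _ "F * G"]) (auto simp: abs_mult intro!: mult_mono F G)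
  \<comment> \<open>\<open>F\<close> and \<open>G\<close> may be negative when \<open>S\<close> is
    empty; the absolute values keep the constant nonnegative.\<close>
  moreover have "(\<bar>F\<bar> * L + K * \<bar>G\<bar>)-lipschitz_on S (\<lambda>x. f x * g x)"
  proof (rule lipschitz_onI)
    fix x y assume xy: "x \<in> S" "y \<in> S"
    have "\<bar>f x * g x - f y * g y\<bar> = \<bar>f x * (g x - g y) + (f x - f y) * g y\<bar>"
      by (simp add: algebra_simps)
    also have "\<dots> \<le> \<bar>f x\<bar> * \<bar>g x - g y\<bar> + \<bar>f x - f y\<bar> * \<bar>g y\<bar>"
      by (metis abs_mult abs_triangle_ineq)
    also have "\<dots> \<le> \<bar>F\<bar> * (L * dist x y) + (K * dist x y) * \<bar>G\<bar>"
      using lipschitz_onD[OF K xy] lipschitz_onD[OF L xy] F[OF xy(1)] G[OF xy(2)]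
        lipschitz_on_nonneg[OF K]
      by (intro add_mono mult_mono) (auto simp: dist_real_def)
    finally show "dist (f x * g x) (f y * g y) \<le> (\<bar>F\<bar> * L + K * \<bar>G\<bar>) * dist x y"
      by (simp add: dist_real_def algebra_simps)
  qed (use lipschitz_on_nonneg[OF K] lipschitz_on_nonneg[OF L] in auto)
  ultimately show ?thesis unfolding bounded_lipschitz_on_def by blast
qed

lemma bounded_lipschitz_on_sum:
  assumes "\<And>i. i \<in> I \<Longrightarrow> bounded_lipschitz_on S (f i)"
  shows "bounded_lipschitz_on S (\<lambda>x. \<Sum>i\<in>I. f i x)"
  using assms
  by (induction I rule: infinite_finite_induct)
    (auto intro: bounded_lipschitz_on_const bounded_lipschitz_on_add)

lemma bounded_lipschitz_on_diff:
  assumes "bounded_lipschitz_on S f" "bounded_lipschitz_on S g"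
  shows "bounded_lipschitz_on S (\<lambda>x. f x - g x)"
  using bounded_lipschitz_on_add[OF assms(1)
      bounded_lipschitz_on_mult[OF bounded_lipschitz_on_const[of S "- 1"] assms(2)]] by simp

lemmas bounded_lipschitz_on_intros =
  bounded_lipschitz_on_const bounded_lipschitz_on_add bounded_lipschitz_on_diff
  bounded_lipschitz_on_mult bounded_lipschitz_on_sum

lemma norm_matrix_vector_mult_le:
  fixes A :: "real ^ 'n ^ 'm"
  assumes "\<And>i j. \<bar>A $ i $ j\<bar> \<le> B"
  shows "norm (A *v x) \<le> real CARD('m) * real CARD('n) * B * norm x"
proof -
  have "norm (A *v x) \<le> (\<Sum>i\<in>UNIV. \<bar>(A *v x) $ i\<bar>)" by (rule norm_le_l1_cart)
  also have "\<dots> \<le> (\<Sum>i\<in>UNIV. \<Sum>j\<in>UNIV. \<bar>A $ i $ j * x $ j\<bar>)"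
    unfolding matrix_vector_mult_def vec_lambda_beta by (intro sum_mono sum_abs)
  also have "\<dots> \<le> (\<Sum>i\<in>(UNIV :: 'm set). \<Sum>j\<in>(UNIV :: 'n set). B * norm x)"
    using assms order_trans[OF abs_ge_zero assms]
    by (intro sum_mono) (auto simp: abs_mult intro!: mult_mono component_le_norm_cart)
  finally show ?thesis by simp
qed

text \<open>Turns entrywise information, which explicit formulas for Jacobians provide, into bounds
  on the action of the matrix that are uniform over \<open>S\<close>.\<close>

lemma bounded_lipschitz_matrix:
  fixes K :: "'a::metric_space \<Rightarrow> real ^ 'n ^ 'm"
  assumes "\<And>i j. bounded_lipschitz_on S (\<lambda>h. K h $ i $ j)"
  obtains B L where "B > 0" "L > 0"
    "\<And>h x. h \<in> S \<Longrightarrow> norm (K h *v x) \<le> B * norm x"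
    "\<And>g h x. g \<in> S \<Longrightarrow> h \<in> S \<Longrightarrow> norm (K h *v x - K g *v x) \<le> L * dist h g * norm x"
proof -
  from assms have "\<forall>i j. \<exists>B L. (\<forall>h\<in>S. \<bar>K h $ i $ j\<bar> \<le> B) \<and> L-lipschitz_on S (\<lambda>h. K h $ i $ j)"
    unfolding bounded_lipschitz_on_def bounded_iff by auto
  then obtain b l where b: "\<And>i j h. h \<in> S \<Longrightarrow> \<bar>K h $ i $ j\<bar> \<le> b i j"
    and l: "\<And>i j. (l i j)-lipschitz_on S (\<lambda>h. K h $ i $ j)"
    by metis
  define B where "B = (\<Sum>i\<in>UNIV. \<Sum>j\<in>UNIV. \<bar>b i j\<bar>)"
  define L where "L = (\<Sum>i\<in>UNIV. \<Sum>j\<in>UNIV. \<bar>l i j\<bar>)"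
  have le: "c i j \<le> (\<Sum>i\<in>UNIV. \<Sum>j\<in>UNIV. \<bar>c i j\<bar>)" for i j and c :: "'m \<Rightarrow> 'n \<Rightarrow> real"
  proof -
    have "c i j \<le> (\<Sum>j\<in>UNIV. \<bar>c i j\<bar>)"
      using member_le_sum[of j UNIV "\<lambda>j. \<bar>c i j\<bar>"] by auto
    also have "\<dots> \<le> (\<Sum>i\<in>UNIV. \<Sum>j\<in>UNIV. \<bar>c i j\<bar>)"
      using member_le_sum[of i UNIV "\<lambda>i. \<Sum>j\<in>UNIV. \<bar>c i j\<bar>"] by (auto intro: sum_nonneg)
    finally show ?thesis .
  qed
  have BL: "B \<ge> 0" "L \<ge> 0" by (auto simp: B_def L_def intro!: sum_nonneg)
  let ?n = "real CARD('m) * real CARD('n)"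
  show thesis
  proof
    \<comment> \<open>Adding 1 makes both constants strictly positive.\<close>
    show "?n * B + 1 > 0" "?n * L + 1 > 0" using BL by (auto intro!: add_nonneg_pos)
    show "norm (K h *v x) \<le> (?n * B + 1) * norm x" if "h \<in> S" for h x
    proof -
      have "norm (K h *v x) \<le> ?n * B * norm x"
        using order_trans[OF b[OF that] le[of b]] by (intro norm_matrix_vector_mult_le) (auto simp: B_def)
      then show ?thesis using norm_ge_zero[of x] unfolding ring_distribs by linarith
    qed
    show "norm (K h *v x - K g *v x) \<le> (?n * L + 1) * dist h g * norm x"
      if "g \<in> S" "h \<in> S" for g h x
    proof -
      have "\<bar>(K h - K g) $ i $ j\<bar> \<le> L * dist h g" for i j
      proof -
        have "\<bar>(K h - K g) $ i $ j\<bar> \<le> l i j * dist h g"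
          using lipschitz_onD[OF l that(2,1)] by (simp add: dist_real_def)
        also have "\<dots> \<le> L * dist h g"
          using le[of l] by (intro mult_right_mono) (auto simp: L_def)
        finally show ?thesis .
      qed
      then have "norm ((K h - K g) *v x) \<le> ?n * (L * dist h g) * norm x"
        by (rule norm_matrix_vector_mult_le)
      moreover have "0 \<le> dist h g * norm x" by simp
      ultimately show ?thesis
        unfolding matrix_vector_mult_diff_rdistrib ring_distribs mult_1 mult.assoc by linarith
    qed
  qed
qed

section \<open>Derivatives within a set and the Newton remainder\<close>

lemma has_derivative_vec_lambda:
  fixes f :: "'n::finite \<Rightarrow> 'a::real_normed_vector \<Rightarrow> real"
  assumes "\<And>i. (f i has_derivative f' i) (at x within S)"
  shows "((\<lambda>y. \<chi> i. f i y) has_derivative (\<lambda>y. \<chi> i. f' i y)) (at x within S)"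
proof (subst has_derivative_componentwise_within, rule ballI)
  fix u :: "real ^ 'n" assume "u \<in> Basis"
  then obtain i where "u = axis i 1" by (auto simp: Basis_vec_def)
  then show "((\<lambda>y. (\<chi> i. f i y) \<bullet> u) has_derivative (\<lambda>y. (\<chi> i. f' i y) \<bullet> u)) (at x within S)"
    using assms by (simp add: inner_axis)
qed

text \<open>Along the segment from \<open>a\<close> to \<open>b\<close> the derivative differs from
  \<open>f' b\<close> by at most \<open>L * norm (b - a)\<close>, and the mean value inequality adds
  another factor \<open>norm (b - a)\<close>. The linearization is at the endpoint \<open>b\<close>,
  which will be the current iterate, with \<open>a\<close> the equilibrium.\<close>

lemma quadratic_remainder_bound:
  fixes f :: "'a::real_normed_vector \<Rightarrow> 'b::real_normed_vector"
  assumes "convex S" and ab: "a \<in> S" "b \<in> S"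
    and f': "\<And>x. x \<in> S \<Longrightarrow> (f has_derivative f' x) (at x within S)"
    and L: "\<And>x y v. x \<in> S \<Longrightarrow> y \<in> S \<Longrightarrow> norm (f' x v - f' y v) \<le> L * dist x y * norm v"
    and "L \<ge> 0"
  shows "norm (f b - f a - f' b (b - a)) \<le> L * (norm (b - a))\<^sup>2"
proof -
  let ?T = "closed_segment a b"
  have T: "?T \<subseteq> S" using assms by (simp add: closed_segment_subset)
  have "norm (f b - f a - f' b (b - a)) \<le> norm (b - a) * (L * norm (b - a))"
  proof (rule differentiable_bound_linearization[where S="?T" and f'=f'])
    show "a + t *\<^sub>R (b - a) \<in> ?T" if "t \<in> {0..1}" for t
      using that by (auto simp: closed_segment_def algebra_simps intro!: exI[of _ t])
    fix x assume x: "x \<in> ?T"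
    then show "(f has_derivative f' x) (at x within ?T)"
      using f' T by (blast intro: has_derivative_subset)
    have "dist x b \<le> norm (b - a)"
      using x segment_bound[of x a b] by (simp add: dist_norm norm_minus_commute)
    then have "L * dist x b * norm v \<le> L * norm (b - a) * norm v" for v
      using \<open>L \<ge> 0\<close> by (intro mult_left_mono mult_right_mono) auto
    moreover have "norm (f' x v - f' b v) \<le> L * dist x b * norm v" for v
      using L x T ab by blast
    ultimately have "norm ((f' x - f' b) v) \<le> L * norm (b - a) * norm v" for v
      unfolding minus_apply by (rule order_trans[rotated])
    then show "onorm (f' x - f' b) \<le> L * norm (b - a)"
      using \<open>L \<ge> 0\<close> by (intro onorm_bound) auto
  qed auto
  then show ?thesis by (simp add: power2_eq_square mult_ac)
qed

section \<open>Costs and choice probabilities on the feasible set\<close>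

lemma paths_of_iff [simp]: "i \<in> paths_of N w \<longleftrightarrow> od N i = w"
  by (simp add: paths_of_def)

lemma convex_feasible: "convex {h. feasible N h}"
  unfolding convex_def feasible_def
  by (auto simp: sum.distrib sum_distrib_left[symmetric] ring_distribs[symmetric])

lemma feasible_le_demand:
  assumes "feasible N h"
  shows "h $ i \<le> demand N (od N i)"
proof -
  have "h $ i \<le> (\<Sum>j\<in>paths_of N (od N i). h $ j)"
    using assms by (intro member_le_sum) (auto simp: feasible_def)
  then show ?thesis using assms by (simp add: feasible_def)
qed

lemma bounded_feasible: "bounded {h. feasible N h}"
proof (rule boundedI)
  fix h assume "h \<in> {h. feasible N h}"
  then have "\<bar>h $ i\<bar> \<le> demand N (od N i)" for i
    using feasible_le_demand[of N h i] by (simp add: feasible_def)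
  then show "norm h \<le> (\<Sum>i\<in>UNIV. demand N (od N i))"
    by (intro order_trans[OF norm_le_l1_cart] sum_mono)
qed

section \<open>Link flows and path costs\<close>

lemma link_flow_nonneg: "feasible N h \<Longrightarrow> link_flow N h $ l \<ge> 0"
  by (auto simp: link_flow_def incidence_def matrix_vector_mult_def feasible_def intro!: sum_nonneg)

lemma bounded_linear_link_flow: "bounded_linear (\<lambda>h. link_flow N h $ l)"
  unfolding link_flow_def
  by (intro bounded_linear_compose[OF bounded_linear_vec_nth] matrix_vector_mul_bounded_linear)

text \<open>Difference quotients of a monotone function are nonnegative, and their limit inherits
  the sign.\<close>

lemma link_cost_deriv_nonneg:
  assumes N: "logit_network N" and a: "a \<ge> 0"
  shows "link_cost_deriv N l a \<ge> 0"
proof -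
  have mono: "mono_on {0..} (link_cost N l)"
    and der: "(link_cost N l has_real_derivative link_cost_deriv N l a) (at a within {0..})"
    using N a by (auto simp: logit_network_def)
  have "((\<lambda>y. (link_cost N l y - link_cost N l a) / (y - a)) \<longlongrightarrow> link_cost_deriv N l a)
      (at a within {0..})"
    using der by (simp add: has_field_derivative_iff)
  moreover have "\<forall>\<^sub>F y in at a within {0..}. 0 \<le> (link_cost N l y - link_cost N l a) / (y - a)"
    unfolding eventually_at_filter
    using a mono by (intro always_eventually)
      (auto simp: zero_le_divide_iff not_le dest: mono_onD[of _ _ a] mono_onD[of _ _ _ a])
  \<comment> \<open>Approach from the right stays inside \<open>{0..}\<close>, also at the boundary
    point \<open>a = 0\<close>.\<close>
  moreover have "at a within {0..} \<noteq> bot"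
  proof -
    have "at_right a \<le> at a within {0..}" using a by (intro at_le) auto
    then show ?thesis using trivial_limit_at_right_real[of a] by (metis bot.extremum_uniqueI)
  qed
  ultimately show ?thesis by (intro tendsto_lowerbound)
qed

lemma bounded_lipschitz_link_cost_deriv:
  assumes "logit_network N"
  shows "bounded_lipschitz_on {h. feasible N h} (\<lambda>h. link_cost_deriv N l (link_flow N h $ l))"
proof -
  obtain B where B: "B-lipschitz_on {link_flow N h $ l | h. feasible N h} (link_cost_deriv N l)"
    using assms unfolding logit_network_def by blast
  obtain C where "C-lipschitz_on {h. feasible N h} (\<lambda>h. link_flow N h $ l)"
    using bounded_linear.lipschitz_boundE[OF bounded_linear_link_flow] .
  moreover have "{link_flow N h $ l | h. feasible N h} = (\<lambda>h. link_flow N h $ l) ` {h. feasible N h}"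
    by auto
  ultimately show ?thesis
    using B by (intro bounded_lipschitz_onI[OF lipschitz_on_compose2 bounded_feasible]) auto
qed

lemma path_cost_jacobian_component:
  "path_cost_jacobian N h $ i $ j =
     (\<Sum>l\<in>UNIV. incidence N $ l $ i * link_cost_deriv N l (link_flow N h $ l) * incidence N $ l $ j)"
  by (simp add: path_cost_jacobian_def matrix_matrix_mult_def transpose_def diag_matrix_def
      if_distrib cong: if_cong)

lemma path_cost_jacobian_mult:
  fixes N :: "('v, 'l::finite, 'o, 'p::finite) network"
  shows
  "path_cost_jacobian N h *v x =
     transpose (incidence N) *v
       (\<chi> l. link_cost_deriv N l (link_flow N h $ l) * link_flow N x $ l)"
proof -
  have "diag_matrix v *v y = (\<chi> l. v $ l * y $ l)" for v y :: "real ^ 'l"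
    by (simp add: diag_matrix_def matrix_vector_mult_def vec_eq_iff if_distrib[of "\<lambda>z. z * _"]
        cong: if_cong)
  then show ?thesis
    by (simp add: path_cost_jacobian_def matrix_vector_mul_assoc[symmetric] link_flow_def)
qed

lemma has_derivative_path_cost:
  assumes N: "logit_network N" and h: "feasible N h"
  shows "(path_cost N has_derivative (\<lambda>v. path_cost_jacobian N h *v v)) (at h within {h. feasible N h})"
proof -
  \<comment> \<open>The chain rule is applied within sets: link flows send the feasible set into
    \<open>{0..}\<close>, where the possibly one-sided derivative of the link cost is
    available.\<close>
  have "((\<lambda>h. link_cost N l (link_flow N h $ l)) has_derivative
      (\<lambda>v. link_cost_deriv N l (link_flow N h $ l) * link_flow N v $ l)) (at h within {h. feasible N h})"
    for l
  proof (rule has_derivative_in_compose2[where t="{0..}" and g="link_cost N l"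
        and g'="\<lambda>a v. link_cost_deriv N l a * v"])
    show "(link_cost N l has_derivative (*) (link_cost_deriv N l a)) (at a within {0..})"
      if "a \<in> {0..}" for a
      using N that by (auto simp: logit_network_def has_field_derivative_def)
    show "((\<lambda>h. link_flow N h $ l) has_derivative (\<lambda>v. link_flow N v $ l))
        (at h within {h. feasible N h})"
      by (rule bounded_linear_imp_has_derivative[OF bounded_linear_link_flow])
  qed (use h link_flow_nonneg in auto)
  then show ?thesis
    unfolding path_cost_def path_cost_jacobian_mult
    by (intro bounded_linear.has_derivative[OF matrix_vector_mul_bounded_linear]
        has_derivative_vec_lambda)
qed

text \<open>Moving the transposed incidence matrix to the other side of the inner product leaves a
  sum of squared link flows of \<open>x\<close>, weighted by the nonnegative link cost
  derivatives.\<close>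

lemma path_cost_jacobian_psd:
  fixes N :: "('a, 'b::finite, 'c::finite, 'd::finite) network"
  assumes "logit_network N" "feasible N h"
  shows "0 \<le> x \<bullet> (path_cost_jacobian N h *v x)"
proof -
  have transp: "x \<bullet> (transpose A *v z) = (A *v x) \<bullet> z" for A :: "real ^ 'd ^ 'b" and z
    by (metis dot_lmul_matrix vector_transpose_matrix)
  have "x \<bullet> (path_cost_jacobian N h *v x) =
      link_flow N x \<bullet> (\<chi> l. link_cost_deriv N l (link_flow N h $ l) * link_flow N x $ l)"
    unfolding path_cost_jacobian_mult transp by (simp add: link_flow_def)
  also have "\<dots> \<ge> 0"
    using link_cost_deriv_nonneg[OF assms(1) link_flow_nonneg[OF assms(2)]]
    unfolding inner_vec_def vec_lambda_beta inner_real_def mult.left_commute[of _ "link_cost_deriv N _ _"]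
    by (intro sum_nonneg mult_nonneg_nonneg zero_le_square)
  finally show ?thesis .
qed

section \<open>Choice probabilities and their derivative\<close>

lemma choice_prob_pos: "0 < choice_prob N \<theta> c $ i"
  unfolding choice_prob_def by (auto intro!: divide_pos_pos sum_pos simp: paths_of_def)

lemma choice_prob_le_1: "choice_prob N \<theta> c $ i \<le> 1"
proof -
  have "exp (- \<theta> * c $ i) \<le> (\<Sum>j\<in>paths_of N (od N i). exp (- \<theta> * c $ j))"
    by (intro member_le_sum) auto
  then show ?thesis
    unfolding choice_prob_def by (simp add: divide_le_eq_1 order_less_le_trans[OF exp_gt_zero])
qed

lemma sum_choice_prob:
  assumes "paths_of N w \<noteq> {}"
  shows "(\<Sum>i\<in>paths_of N w. choice_prob N \<theta> c $ i) = 1"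
proof -
  have "(\<Sum>i\<in>paths_of N w. choice_prob N \<theta> c $ i) =
      (\<Sum>i\<in>paths_of N w. exp (- \<theta> * c $ i) / (\<Sum>j\<in>paths_of N w. exp (- \<theta> * c $ j)))"
    by (intro sum.cong) (auto simp: choice_prob_def)
  also have "\<dots> = 1"
    using assms sum_pos[of "paths_of N w" "\<lambda>j. exp (- \<theta> * c $ j)"]
    by (simp add: sum_divide_distrib[symmetric])
  finally show ?thesis .
qed

text \<open>The average is that of the cost change \<open>y\<close>, under the logit distribution at
  \<open>c\<close>. For \<open>\<theta> > 0\<close> it is the derivative in direction
  \<open>y\<close> of the logsum cost
  \<open>- ln (\<Sum>j. exp (- \<theta> * c $ j)) / \<theta>\<close> of the OD pair.\<close>

definition mean_cost ::
    "('v, 'l, 'o, 'p::finite) network \<Rightarrow> real \<Rightarrow> real ^ 'p \<Rightarrow> 'o \<Rightarrow> real ^ 'p \<Rightarrow> real" where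
  "mean_cost N \<theta> c w y = (\<Sum>j\<in>paths_of N w. choice_prob N \<theta> c $ j * y $ j)"

text \<open>The quotient rule for a softmax: the numerator contributes \<open>y $ i\<close>, the
  denominator the mean. The centred form is chosen because it exposes the covariance
  structure.\<close>

lemma has_derivative_choice_prob:
  "(choice_prob N \<theta> has_derivative
     (\<lambda>y. \<chi> i. - \<theta> * choice_prob N \<theta> c $ i * (y $ i - mean_cost N \<theta> c (od N i) y))) (at c)"
proof -
  have "((\<lambda>c. exp (- \<theta> * c $ i) / (\<Sum>j\<in>paths_of N (od N i). exp (- \<theta> * c $ j))) has_derivative
      (\<lambda>y. - \<theta> * choice_prob N \<theta> c $ i * (y $ i - mean_cost N \<theta> c (od N i) y))) (at c)" for i
  proof -
    let ?s = "\<Sum>j\<in>paths_of N (od N i). exp (- \<theta> * c $ j)"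
    have s: "?s \<noteq> 0" using sum_pos[of "paths_of N (od N i)" "\<lambda>j. exp (- \<theta> * c $ j)"]
      by (force simp: paths_of_def)
    have e: "((\<lambda>c. exp (- \<theta> * c $ j)) has_derivative (\<lambda>y. - \<theta> * y $ j * exp (- \<theta> * c $ j))) (at c)" for j
      by (auto intro!: derivative_eq_intros bounded_linear_imp_has_derivative)
    have m: "mean_cost N \<theta> c (od N i) y =
        (\<Sum>j\<in>paths_of N (od N i). exp (- \<theta> * c $ j) * y $ j) / ?s" for y
      unfolding mean_cost_def sum_divide_distrib by (intro sum.cong) (auto simp: choice_prob_def)
    have d: "(\<Sum>j\<in>paths_of N (od N i). - \<theta> * y $ j * exp (- \<theta> * c $ j)) =
        - \<theta> * (\<Sum>j\<in>paths_of N (od N i). exp (- \<theta> * c $ j) * y $ j)" for y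
      unfolding sum_distrib_left by (intro sum.cong) auto
    have "((\<lambda>c. exp (- \<theta> * c $ i) / (\<Sum>j\<in>paths_of N (od N i). exp (- \<theta> * c $ j))) has_derivative
      (\<lambda>y. (- \<theta> * y $ i * exp (- \<theta> * c $ i) * ?s - exp (- \<theta> * c $ i) *
        (\<Sum>j\<in>paths_of N (od N i). - \<theta> * y $ j * exp (- \<theta> * c $ j))) / (?s * ?s))) (at c)"
      by (intro has_derivative_divide' has_derivative_sum e s)
    then show ?thesis
      unfolding d m choice_prob_def
      by (rule has_derivative_eq_rhs) (use s in \<open>simp add: fun_eq_iff field_simps\<close>)
  qed
  then show ?thesis unfolding choice_prob_def[abs_def] by (rule has_derivative_vec_lambda)
qed

section \<open>Action of the reduced Jacobian\<close>

lemma linear_assign: "linear (assign N h)"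
  by (rule linearI) (auto simp: assign_def vec_eq_iff algebra_simps)

lemma matrix_jacobian_mult:
  fixes f :: "real ^ 'n \<Rightarrow> real ^ 'm"
  assumes "(f has_derivative f') (at x)"
  shows "jacobian f (at x) *v v = f' v"
  unfolding jacobian_def frechet_derivative_at[OF assms, symmetric]
  by (rule fun_cong[OF matrix_vector_mul(2)[OF has_derivative_linear[OF assms]]])

text \<open>The three factors act in turn: path costs change by \<open>y\<close>, choice
  probabilities respond by the centred formula, and feasibility turns the OD flow sums in
  \<open>assign\<close> into demands.\<close>

lemma reduced_jacobian_mult:
  assumes "feasible N h"
  shows "reduced_jacobian N \<theta> h *v x = (let y = path_cost_jacobian N h *v x in
    \<chi> i. - (\<theta> * demand N (od N i) * choice_prob N \<theta> (path_cost N h) $ i *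
      (y $ i - mean_cost N \<theta> (path_cost N h) (od N i) y)))"
proof -
  have "jacobian (assign N h) (at p) *v v = assign N h v" for p v
    using linear_assign
    by (intro matrix_jacobian_mult bounded_linear_imp_has_derivative)
      (simp add: linear_conv_bounded_linear)
  then show ?thesis
    using assms
    unfolding reduced_jacobian_def Let_def matrix_vector_mul_assoc[symmetric]
      matrix_jacobian_mult[OF has_derivative_choice_prob]
    by (simp add: assign_def feasible_def vec_eq_iff)
qed

text \<open>Vectors with zero sum over each OD pair are orthogonal to those constant on each pair.
  This is what allows a cost change to be centred inside an inner product.\<close>

lemma sum_mult_od_eq_0:
  fixes N :: "('v, 'l, 'o::finite, 'p::finite) network" and f :: "'p \<Rightarrow> real"
  assumes "\<And>w. (\<Sum>i\<in>paths_of N w. f i) = 0"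
  shows "(\<Sum>i\<in>UNIV. f i * m (od N i)) = 0"
proof -
  have "(\<Sum>i\<in>UNIV. f i * m (od N i)) = (\<Sum>w\<in>UNIV. \<Sum>i\<in>paths_of N w. f i * m (od N i))"
    unfolding paths_of_def using sum.group[of UNIV UNIV "od N" "\<lambda>i. f i * m (od N i)"] by simp
  also have "\<dots> = (\<Sum>w\<in>UNIV. (\<Sum>i\<in>paths_of N w. f i) * m w)"
    unfolding sum_distrib_right by (intro sum.cong) auto
  finally show ?thesis by (simp add: assms)
qed

section \<open>Bounds uniform over the feasible set\<close>

lemma path_cost_jacobian_bound:
  fixes N :: "('v, 'l::finite, 'o::finite, 'p::finite) network"
  assumes N: "logit_network N"
  obtains \<mu> where "\<mu> > 0"
    "\<And>h x. feasible N h \<Longrightarrow> norm (path_cost_jacobian N h *v x) \<le> \<mu> * norm x"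
proof -
  have "bounded_lipschitz_on {h. feasible N h} (\<lambda>h. path_cost_jacobian N h $ i $ j)" for i j
    unfolding path_cost_jacobian_component
    by (intro bounded_lipschitz_on_intros bounded_lipschitz_link_cost_deriv N)
  from bounded_lipschitz_matrix[OF this] show thesis
    using that by (metis mem_Collect_eq)
qed

text \<open>With \<open>y\<close> the path cost change along \<open>x\<close>, the vector
  \<open>w\<close> is minus the reduced Jacobian applied to \<open>x\<close>, and
  \<open>w \<bullet> y\<close> is a demand-weighted sum of variances that controls
  \<open>(norm w)\<^sup>2\<close>. The abstract estimate for \<open>x + w = z\<close> then applies,
  with constants independent of \<open>h\<close>.\<close>

lemma norm_le_newton_matrix:
  fixes N :: "('v, 'l::finite, 'o::finite, 'p::finite) network"
  assumes N: "logit_network N" and "\<theta> > 0"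
  obtains \<kappa> where "\<kappa> > 0"
    "\<And>h x. feasible N h \<Longrightarrow> norm x \<le> \<kappa> * norm ((mat 1 - reduced_jacobian N \<theta> h) *v x)"
proof -
  obtain \<mu> where "\<mu> > 0" and
    \<mu>: "\<And>h x. feasible N h \<Longrightarrow> norm (path_cost_jacobian N h *v x) \<le> \<mu> * norm x"
    using path_cost_jacobian_bound[OF N] by blast
  \<comment> \<open>\<open>\<beta>\<close> dominates every weight
    \<open>\<theta> * demand N (od N i) * p $ i\<close>: probabilities are at most 1, and each
    demand is at most the total.\<close>
  define \<beta> where "\<beta> = \<theta> * (\<Sum>w\<in>UNIV. demand N w)"
  have d: "demand N w \<ge> 0" for w using N by (auto simp: logit_network_def)
  then have "\<beta> \<ge> 0" using \<open>\<theta> > 0\<close> by (simp add: \<beta>_def sum_nonneg)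
  show thesis
  proof
    show "\<beta> * \<mu> + 2 > 0" using \<open>\<beta> \<ge> 0\<close> \<open>\<mu> > 0\<close> by (intro add_nonneg_pos) auto
    fix h x assume h: "feasible N h"
    define y where "y = path_cost_jacobian N h *v x"
    define p where "p = choice_prob N \<theta> (path_cost N h)"
    define m where "m w = mean_cost N \<theta> (path_cost N h) w y" for w
    define w where "w = (\<chi> i. \<theta> * demand N (od N i) * p $ i * (y $ i - m (od N i)))"
    have K: "reduced_jacobian N \<theta> h *v x = - w"
      unfolding reduced_jacobian_mult[OF h] w_def y_def m_def p_def by (simp add: Let_def vec_eq_iff)
    have "(\<Sum>i\<in>paths_of N v. w $ i) = 0" for v
    proof -
      have "(\<Sum>i\<in>paths_of N v. w $ i) =
          \<theta> * demand N v * ((\<Sum>i\<in>paths_of N v. p $ i * y $ i) - (\<Sum>i\<in>paths_of N v. p $ i) * m v)"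
        unfolding sum_distrib_left sum_distrib_right sum_subtractf[symmetric]
        by (intro sum.cong) (auto simp: w_def algebra_simps)
      also have "(\<Sum>i\<in>paths_of N v. p $ i) = 1"
        using N unfolding p_def logit_network_def by (intro sum_choice_prob) blast
      finally show ?thesis by (simp add: m_def mean_cost_def p_def)
    qed
    then have "(\<Sum>i\<in>UNIV. w $ i * m (od N i)) = 0" by (rule sum_mult_od_eq_0)
    \<comment> \<open>Subtracting the OD means from \<open>y\<close> leaves the inner product with
      \<open>w\<close> unchanged and makes each summand a nonnegative weight times a square.\<close>
    then have wy: "w \<bullet> y = (\<Sum>i\<in>UNIV. w $ i * (y $ i - m (od N i)))"
      by (simp add: inner_vec_def right_diff_distrib sum_subtractf)
    have "(norm w)\<^sup>2 = (\<Sum>i\<in>UNIV. w $ i * w $ i)"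
      by (simp add: power2_norm_eq_inner inner_vec_def)
    also have "\<dots> \<le> (\<Sum>i\<in>UNIV. \<beta> * (w $ i * (y $ i - m (od N i))))"
    proof (rule sum_mono)
      fix i
      let ?a = "demand N (od N i) * p $ i" and ?u = "y $ i - m (od N i)"
      have p: "0 \<le> p $ i" "p $ i \<le> 1"
        unfolding p_def using choice_prob_pos[of N \<theta> _ i] choice_prob_le_1[of N \<theta> _ i]
        by (auto simp: less_imp_le)
      have "?a \<le> demand N (od N i)"
        using mult_left_mono[OF p(2) d[of "od N i"]] by simp
      also have "\<dots> \<le> (\<Sum>w\<in>UNIV. demand N w)" by (rule member_le_sum) (auto simp: d)
      finally have "\<theta> * ?a \<le> \<beta>" using \<open>\<theta> > 0\<close> by (simp add: \<beta>_def)
      then have "\<theta> * ?a * (\<theta> * ?a * (?u * ?u)) \<le> \<beta> * (\<theta> * ?a * (?u * ?u))"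
        using \<open>\<theta> > 0\<close> p d by (intro mult_right_mono mult_nonneg_nonneg zero_le_square) auto
      then show "w $ i * w $ i \<le> \<beta> * (w $ i * ?u)" by (simp add: w_def mult_ac)
    qed
    finally have "(norm w)\<^sup>2 \<le> \<beta> * (w \<bullet> y)" by (simp add: wy sum_distrib_left)
    then show "norm x \<le> (\<beta> * \<mu> + 2) * norm ((mat 1 - reduced_jacobian N \<theta> h) *v x)"
      using h \<open>\<beta> \<ge> 0\<close> \<open>\<mu> > 0\<close> \<mu>[of h x] path_cost_jacobian_psd[OF N h, of x]
      by (intro norm_le_norm_add_psd_image[where w=w and y=y])
        (auto simp: y_def matrix_vector_mult_diff_rdistrib K)
  qed
qed

lemma bounded_lipschitz_choice_prob:
  fixes N :: "('v, 'l::finite, 'o::finite, 'p::finite) network"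
  assumes N: "logit_network N"
  shows "bounded_lipschitz_on {h. feasible N h} (\<lambda>h. choice_prob N \<theta> (path_cost N h) $ i)"
proof -
  obtain \<mu> where "\<mu> > 0" and
    \<mu>: "\<And>h x. feasible N h \<Longrightarrow> norm (path_cost_jacobian N h *v x) \<le> \<mu> * norm x"
    using path_cost_jacobian_bound[OF N] by blast
  \<comment> \<open>The factors come from the softmax derivative, from centring (\<open>y\<close>
    itself plus at most \<open>CARD('p)\<close> terms of the mean), and from the bound
    \<open>\<mu>\<close> on the path cost Jacobian.\<close>
  let ?B = "\<bar>\<theta>\<bar> * ((1 + real CARD('p)) * \<mu>)"
  have "?B-lipschitz_on {h. feasible N h} (\<lambda>h. choice_prob N \<theta> (path_cost N h) $ i)"
  proof (rule bounded_derivative_imp_lipschitz[OF _ convex_feasible])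
    show "?B \<ge> 0" using \<open>\<mu> > 0\<close> by simp
    fix h assume h: "h \<in> {h. feasible N h}"
    let ?p = "choice_prob N \<theta> (path_cost N h)"
    let ?D = "\<lambda>v. let y = path_cost_jacobian N h *v v in
      - \<theta> * ?p $ i * (y $ i - mean_cost N \<theta> (path_cost N h) (od N i) y)"
    show "((\<lambda>h. choice_prob N \<theta> (path_cost N h) $ i) has_derivative ?D) (at h within {h. feasible N h})"
      using bounded_linear.has_derivative[OF bounded_linear_vec_nth[of i]
          has_derivative_compose[OF has_derivative_path_cost[OF N] has_derivative_choice_prob[of N \<theta>]]] h
      by (simp add: Let_def)
    show "onorm ?D \<le> ?B"
    proof (rule onorm_bound)
      fix v
      define y where "y = path_cost_jacobian N h *v v"
      have p: "\<bar>?p $ j\<bar> \<le> 1" for j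
        using choice_prob_pos[of N \<theta> _ j] choice_prob_le_1[of N \<theta> _ j] by (simp add: less_imp_le)
      have "\<bar>mean_cost N \<theta> (path_cost N h) (od N i) y\<bar> \<le> (\<Sum>j\<in>paths_of N (od N i). \<bar>?p $ j * y $ j\<bar>)"
        unfolding mean_cost_def by (rule sum_abs)
      also have "\<dots> \<le> (\<Sum>j\<in>UNIV. \<bar>?p $ j * y $ j\<bar>)" by (rule sum_mono2) auto
      also have "\<dots> \<le> (\<Sum>j\<in>(UNIV :: 'p set). 1 * norm y)"
        unfolding abs_mult by (intro sum_mono mult_mono p component_le_norm_cart) auto
      finally have "\<bar>y $ i - mean_cost N \<theta> (path_cost N h) (od N i) y\<bar> \<le> (1 + real CARD('p)) * norm y"
        using component_le_norm_cart[of y i] by (simp add: algebra_simps)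
      also have "\<dots> \<le> (1 + real CARD('p)) * (\<mu> * norm v)"
        unfolding y_def using h by (intro mult_left_mono \<mu>) auto
      finally have "\<bar>\<theta>\<bar> * \<bar>?p $ i\<bar> * \<bar>y $ i - mean_cost N \<theta> (path_cost N h) (od N i) y\<bar>
          \<le> (\<bar>\<theta>\<bar> * 1) * ((1 + real CARD('p)) * (\<mu> * norm v))"
        by (intro mult_mono p) auto
      then show "norm (?D v) \<le> ?B * norm v" by (simp add: Let_def y_def abs_mult mult_ac)
    qed (use \<open>\<mu> > 0\<close> in simp)
  qed
  then show ?thesis by (rule bounded_lipschitz_onI[OF _ bounded_feasible])
qed

text \<open>Applying the matrix to basis vectors shows each entry to be a polynomial in choice
  probabilities and link cost derivatives, all bounded and Lipschitz over the feasible set.\<close>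

lemma bounded_lipschitz_reduced_jacobian:
  fixes N :: "('v, 'l::finite, 'o::finite, 'p::finite) network"
  assumes N: "logit_network N"
  shows "bounded_lipschitz_on {h. feasible N h} (\<lambda>h. reduced_jacobian N \<theta> h $ i $ j)"
proof -
  have col: "(A *v axis j 1) $ i = A $ i $ j" for A :: "real ^ 'p ^ 'p" and i
    by (simp add: matrix_vector_mult_basis column_def)
  let ?M = "path_cost_jacobian N" and ?p = "\<lambda>h. choice_prob N \<theta> (path_cost N h)"
  have "reduced_jacobian N \<theta> h $ i $ j = (- \<theta> * demand N (od N i)) * ?p h $ i *
      (?M h $ i $ j - (\<Sum>k\<in>paths_of N (od N i). ?p h $ k * ?M h $ k $ j))" if "feasible N h" for h
    using reduced_jacobian_mult[OF that, of \<theta> "axis j 1"]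
    by (simp add: col[symmetric] mean_cost_def Let_def)
  then have "bounded_lipschitz_on {h. feasible N h} (\<lambda>h. reduced_jacobian N \<theta> h $ i $ j) \<longleftrightarrow>
    bounded_lipschitz_on {h. feasible N h} (\<lambda>h. (- \<theta> * demand N (od N i)) * ?p h $ i *
      (?M h $ i $ j - (\<Sum>k\<in>paths_of N (od N i). ?p h $ k * ?M h $ k $ j)))"
    by (intro bounded_lipschitz_on_cong) simp
  moreover have "bounded_lipschitz_on {h. feasible N h} (\<lambda>h. (- \<theta> * demand N (od N i)) * ?p h $ i *
      (?M h $ i $ j - (\<Sum>k\<in>paths_of N (od N i). ?p h $ k * ?M h $ k $ j)))"
    unfolding path_cost_jacobian_component
    by (intro bounded_lipschitz_on_intros bounded_lipschitz_choice_prob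
        bounded_lipschitz_link_cost_deriv N)
  ultimately show ?thesis by blast
qed

lemma logit_map_feasible:
  "feasible N h \<Longrightarrow>
    logit_map N \<theta> h = (\<chi> i. demand N (od N i) * choice_prob N \<theta> (path_cost N h) $ i)"
  by (simp add: logit_map_def assign_def feasible_def)

text \<open>Within the feasible set the OD sums in \<open>assign\<close> are constantly the demands,
  so only the dependence through the choice probabilities is differentiated, and the derivative of
  \<open>logit_map\<close> is the reduced Jacobian.\<close>

lemma has_derivative_logit_map:
  fixes N :: "('v, 'l::finite, 'o::finite, 'p::finite) network"
  assumes N: "logit_network N" and h: "feasible N h"
  shows "(logit_map N \<theta> has_derivative (\<lambda>v. reduced_jacobian N \<theta> h *v v))
    (at h within {h. feasible N h})"
proof -
  have "((\<lambda>h. \<chi> i. demand N (od N i) * choice_prob N \<theta> (path_cost N h) $ i) has_derivative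
      (\<lambda>v. reduced_jacobian N \<theta> h *v v)) (at h within {h. feasible N h})"
    unfolding reduced_jacobian_mult[OF h] Let_def
  proof (rule has_derivative_vec_lambda)
    fix i
    show "((\<lambda>h. demand N (od N i) * choice_prob N \<theta> (path_cost N h) $ i) has_derivative
        (\<lambda>v. - (\<theta> * demand N (od N i) * choice_prob N \<theta> (path_cost N h) $ i *
          ((path_cost_jacobian N h *v v) $ i -
           mean_cost N \<theta> (path_cost N h) (od N i) (path_cost_jacobian N h *v v)))))
        (at h within {h. feasible N h})"
      using has_derivative_mult_right[OF bounded_linear.has_derivative[OF bounded_linear_vec_nth[of i]
          has_derivative_compose[OF has_derivative_path_cost[OF N h] has_derivative_choice_prob[of N \<theta>]]],
          of "demand N (od N i)"]
      by (simp add: mult_ac)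
  qed
  then show ?thesis
    by (rule has_derivative_transform[rotated 2]) (use h in \<open>auto simp: logit_map_feasible\<close>)
qed

section \<open>Inexact Newton steps\<close>

text \<open>The first condition preserves the OD flow sums. The second treats pairs without demand
  separately: their equilibrium flows are 0 and leave no margin for perturbations.\<close>

definition admissible_directions :: "('v, 'l, 'o, 'p::finite) network \<Rightarrow> (real ^ 'p) set" where
  "admissible_directions N =
     {x. (\<forall>w. (\<Sum>i\<in>paths_of N w. x $ i) = 0) \<and> (\<forall>i. demand N (od N i) = 0 \<longrightarrow> x $ i = 0)}"

lemma subspace_admissible_directions: "subspace (admissible_directions N)"
  by (rule subspaceI)
    (auto simp: admissible_directions_def sum.distrib sum_distrib_left[symmetric])

lemma logit_residual_admissible:
  assumes N: "logit_network N" and h: "feasible N h"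
  shows "logit_residual N \<theta> h \<in> admissible_directions N"
proof -
  have "(\<Sum>i\<in>paths_of N w. logit_map N \<theta> h $ i) = demand N w" for w
  proof -
    have "(\<Sum>i\<in>paths_of N w. logit_map N \<theta> h $ i) =
        demand N w * (\<Sum>i\<in>paths_of N w. choice_prob N \<theta> (path_cost N h) $ i)"
      unfolding logit_map_feasible[OF h] sum_distrib_left by (intro sum.cong) auto
    then show ?thesis using N by (simp add: sum_choice_prob logit_network_def)
  qed
  moreover have "h $ i = 0" if "demand N (od N i) = 0" for i
    using feasible_le_demand[OF h, of i] h that by (auto simp: feasible_def intro: antisym)
  ultimately show ?thesis
    using h by (auto simp: admissible_directions_def logit_residual_def sum_subtractf feasible_def
        logit_map_feasible[OF h])
qed

text \<open>Centring makes the sum over an OD pair vanish because its probabilities add up to 1, and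
  the demand factor gives the zero entries. Hence
  \<open>mat 1 - reduced_jacobian N \<theta> h\<close> leaves the admissible directions
  invariant.\<close>

lemma reduced_jacobian_admissible:
  assumes N: "logit_network N" and h: "feasible N h"
  shows "reduced_jacobian N \<theta> h *v x \<in> admissible_directions N"
proof -
  define y where "y = path_cost_jacobian N h *v x"
  let ?p = "choice_prob N \<theta> (path_cost N h)" and ?m = "\<lambda>w. mean_cost N \<theta> (path_cost N h) w y"
  have K: "(reduced_jacobian N \<theta> h *v x) $ i = - (\<theta> * demand N (od N i) * ?p $ i * (y $ i - ?m (od N i)))"
    for i
    by (simp add: reduced_jacobian_mult[OF h] y_def Let_def)
  have "(\<Sum>i\<in>paths_of N w. (reduced_jacobian N \<theta> h *v x) $ i) = 0" for w
  proof -
    have "(\<Sum>i\<in>paths_of N w. (reduced_jacobian N \<theta> h *v x) $ i) =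
        - (\<theta> * demand N w * ((\<Sum>i\<in>paths_of N w. ?p $ i * y $ i) - (\<Sum>i\<in>paths_of N w. ?p $ i) * ?m w))"
      unfolding sum_distrib_left sum_distrib_right sum_subtractf[symmetric] sum_negf[symmetric]
      by (intro sum.cong) (auto simp: K algebra_simps)
    also have "(\<Sum>i\<in>paths_of N w. ?p $ i) = 1"
      using N unfolding logit_network_def by (intro sum_choice_prob) blast
    finally show ?thesis by (simp add: mean_cost_def)
  qed
  then show ?thesis by (auto simp: admissible_directions_def K)
qed

text \<open>Only signs are at stake: on pairs with demand, an entry within \<open>hhat $ i\<close>
  of \<open>hhat $ i\<close> is nonnegative; on the others the direction is zero.\<close>

lemma feasible_add_admissible:
  assumes N: "logit_network N" and h: "feasible N h" and \<delta>: "\<delta> \<in> admissible_directions N"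
    and near: "\<And>i. demand N (od N i) > 0 \<Longrightarrow> \<bar>(h + \<delta> - hhat) $ i\<bar> \<le> hhat $ i"
  shows "feasible N (h + \<delta>)"
proof -
  have "0 \<le> (h + \<delta>) $ i" for i
  proof (cases "demand N (od N i) = 0")
    case True
    then show ?thesis using \<delta> h by (simp add: admissible_directions_def feasible_def)
  next
    case False
    then have "demand N (od N i) > 0"
      using N by (simp add: logit_network_def order_less_le)
    from near[OF this] show ?thesis by simp
  qed
  then show ?thesis
    using h \<delta> by (simp add: feasible_def admissible_directions_def sum.distrib)
qed


text \<open>The Newton matrix maps the new error to the linearization remainder plus the GMRES
  residual. Both are quadratic in the old error, and the uniform bound \<open>\<kappa>\<close> on
  the inverse carries this over to the new error.\<close>

lemma inexact_newton_step_bound: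
  fixes N :: "('v, 'l::finite, 'o::finite, 'p::finite) network"
  assumes N: "logit_network N" and "\<theta> > 0" and "\<eta> > 0" and "\<nu> > 0"
    and hhat: "feasible N hhat" "hhat = logit_map N \<theta> hhat"
  obtains C where "C > 0"
    "\<And>h \<delta>. feasible N h \<Longrightarrow>
      \<delta> = gmres (mat 1 - reduced_jacobian N \<theta> h) (logit_residual N \<theta> h)
        (min \<eta> (\<nu> * norm (logit_residual N \<theta> h))) \<Longrightarrow>
      norm (h + \<delta> - hhat) \<le> C * (norm (h - hhat))\<^sup>2"
    "\<And>h \<delta>. feasible N h \<Longrightarrow>
      \<delta> = gmres (mat 1 - reduced_jacobian N \<theta> h) (logit_residual N \<theta> h)
        (min \<eta> (\<nu> * norm (logit_residual N \<theta> h))) \<Longrightarrow>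
      \<delta> \<in> admissible_directions N"
proof -
  let ?S = "{h. feasible N h}"
  let ?A = "\<lambda>h. mat 1 - reduced_jacobian N \<theta> h"
  let ?F = "logit_residual N \<theta>"
  obtain \<kappa> where "\<kappa> > 0" and
    \<kappa>: "\<And>h x. feasible N h \<Longrightarrow> norm x \<le> \<kappa> * norm (?A h *v x)"
    using norm_le_newton_matrix[OF N \<open>\<theta> > 0\<close>] by blast
  obtain B L where "B > 0" "L > 0"
    and B: "\<And>h x. h \<in> ?S \<Longrightarrow> norm (reduced_jacobian N \<theta> h *v x) \<le> B * norm x"
    and L: "\<And>g h x. g \<in> ?S \<Longrightarrow> h \<in> ?S \<Longrightarrow>
      norm (reduced_jacobian N \<theta> h *v x - reduced_jacobian N \<theta> g *v x) \<le> L * dist h g * norm x"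
    using bounded_lipschitz_matrix[OF bounded_lipschitz_reduced_jacobian[OF N, of \<theta>]] by blast
  have inj: "inj ((*v) (?A h))" if h: "feasible N h" for h
  proof (rule injI)
    fix x y assume "?A h *v x = ?A h *v y"
    then have "?A h *v (x - y) = 0" by (simp add: matrix_vector_mult_diff_distrib)
    then show "x = y" using \<kappa>[OF h, of "x - y"] by simp
  qed
  \<comment> \<open>The residual vanishes at \<open>hhat\<close>; \<open>B\<close> accounts for the
    variation of the logit map and 1 for that of the identity.\<close>
  have F: "norm (?F h) \<le> (B + 1) * norm (h - hhat)" if h: "feasible N h" for h
  proof -
    have "norm (logit_map N \<theta> h - logit_map N \<theta> hhat) \<le> B * norm (h - hhat)"
    proof (rule differentiable_bound[OF convex_feasible has_derivative_logit_map[OF N]])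
      show "onorm ((*v) (reduced_jacobian N \<theta> g)) \<le> B" if "g \<in> ?S" for g
        using B[OF that] \<open>B > 0\<close> by (intro onorm_bound) auto
    qed (use h hhat in auto)
    moreover have "?F h = (logit_map N \<theta> h - logit_map N \<theta> hhat) - (h - hhat)"
      using hhat by (simp add: logit_residual_def)
    ultimately show ?thesis
      using norm_triangle_ineq4[of "logit_map N \<theta> h - logit_map N \<theta> hhat" "h - hhat"]
      by (simp only: distrib_right)
  qed
  show thesis
  proof
    show "\<kappa> * (L + \<nu> * (B + 1)\<^sup>2) > 0"
      using \<open>\<kappa> > 0\<close> \<open>L > 0\<close> \<open>\<nu> > 0\<close> by (intro mult_pos_pos add_pos_nonneg) auto
    fix h \<delta>
    assume h: "feasible N h"
      and \<delta>: "\<delta> = gmres (?A h) (?F h) (min \<eta> (\<nu> * norm (?F h)))"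
    have "norm (?A h *v \<delta> - ?F h) \<le> min \<eta> (\<nu> * norm (?F h)) * norm (?F h)"
      unfolding \<delta> using \<open>\<eta> > 0\<close> \<open>\<nu> > 0\<close> by (intro gmres_residual_le inj h) auto
    \<comment> \<open>The residual-proportional branch of the minimum is what makes the inexactness
      quadratic.\<close>
    also have "\<dots> \<le> (\<nu> * norm (?F h)) * norm (?F h)" by (intro mult_right_mono) auto
    also have "\<dots> = \<nu> * (norm (?F h))\<^sup>2" by (simp add: power2_eq_square)
    also have "\<dots> \<le> \<nu> * ((B + 1) * norm (h - hhat))\<^sup>2"
      using \<open>\<nu> > 0\<close> F[OF h] by (intro mult_left_mono power_mono) auto
    finally have inexact: "norm (?A h *v \<delta> - ?F h) \<le> \<nu> * (B + 1)\<^sup>2 * (norm (h - hhat))\<^sup>2"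
      by (simp add: power_mult_distrib mult_ac)
    have newton: "norm (logit_map N \<theta> h - logit_map N \<theta> hhat - reduced_jacobian N \<theta> h *v (h - hhat))
        \<le> L * (norm (h - hhat))\<^sup>2"
      using h hhat(1) L \<open>L > 0\<close> has_derivative_logit_map[OF N]
      by (intro quadratic_remainder_bound[OF convex_feasible]) auto
    \<comment> \<open>The fixed point equation lets \<open>logit_map N \<theta> hhat\<close> stand
      for \<open>hhat\<close>.\<close>
    have "?A h *v (h + \<delta> - hhat) =
        (logit_map N \<theta> h - logit_map N \<theta> hhat - reduced_jacobian N \<theta> h *v (h - hhat)) +
        (?A h *v \<delta> - ?F h)"
      using hhat(2)[symmetric]
      by (simp add: logit_residual_def matrix_vector_mult_diff_rdistrib matrix_vector_mult_diff_distrib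
          matrix_vector_right_distrib)
    then have "norm (?A h *v (h + \<delta> - hhat)) \<le> (L + \<nu> * (B + 1)\<^sup>2) * (norm (h - hhat))\<^sup>2"
      using norm_triangle_mono[OF newton inexact] by (simp add: distrib_right)
    then have "\<kappa> * norm (?A h *v (h + \<delta> - hhat)) \<le> \<kappa> * ((L + \<nu> * (B + 1)\<^sup>2) * (norm (h - hhat))\<^sup>2)"
      using \<open>\<kappa> > 0\<close> by (intro mult_left_mono) auto
    with \<kappa>[OF h] show "norm (h + \<delta> - hhat) \<le> \<kappa> * (L + \<nu> * (B + 1)\<^sup>2) * (norm (h - hhat))\<^sup>2"
      unfolding mult.assoc by (rule order_trans)
    show "\<delta> \<in> admissible_directions N"
      unfolding \<delta>
    proof (rule gmres_in_subspace[OF subspace_admissible_directions logit_residual_admissible[OF N h]])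
      show "?A h *v x \<in> admissible_directions N" if "x \<in> admissible_directions N" for x
        unfolding matrix_vector_mult_diff_rdistrib matrix_vector_mul_lid
        by (rule subspace_diff[OF subspace_admissible_directions that reduced_jacobian_admissible[OF N h]])
    qed
  qed
qed

section \<open>Local quadratic convergence to the equilibrium\<close>

theorem proposition2:
  fixes N :: "('v, 'l::finite, 'o::finite, 'p::finite) network"
    and \<theta> \<eta>tol \<nu>2 :: real
    and hhat :: "real ^ 'p"
  assumes "logit_network N"
    and "\<theta> > 0"
    and "0 < \<eta>tol" and "\<eta>tol < 1" and "\<nu>2 > 0"
    and "feasible N hhat" and "hhat = logit_map N \<theta> hhat"
  shows "\<exists>U. open U \<and> hhat \<in> U \<and>
    (\<forall>h0\<in>U. feasible N h0 \<longrightarrow>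
       inexact_newton N \<theta> \<eta>tol \<nu>2 h0 \<longlonglongrightarrow> hhat \<and>
       (\<exists>C>0. \<forall>k.
          norm (inexact_newton N \<theta> \<eta>tol \<nu>2 h0 (Suc k) - hhat)
            \<le> C * (norm (inexact_newton N \<theta> \<eta>tol \<nu>2 h0 k - hhat))\<^sup>2))"
proof -
  note N = assms(1) and hhat = assms(6,7)
  let ?\<delta> = "\<lambda>h. gmres (mat 1 - reduced_jacobian N \<theta> h) (logit_residual N \<theta> h)
    (min \<eta>tol (\<nu>2 * norm (logit_residual N \<theta> h)))"
  obtain C where "C > 0"
    and C: "\<And>h. feasible N h \<Longrightarrow> norm (h + ?\<delta> h - hhat) \<le> C * (norm (h - hhat))\<^sup>2"
    and adm: "\<And>h. feasible N h \<Longrightarrow> ?\<delta> h \<in> admissible_directions N"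
    using inexact_newton_step_bound[OF assms(1-3,5-7)] by metis
  \<comment> \<open>The radius must satisfy two demands: at most \<open>1 / (2 * C)\<close> so that
    a step halves the error, and at most each equilibrium flow on a pair with demand so that
    iterates stay feasible. The inserted element keeps \<open>E\<close> nonempty when no pair has
    demand.\<close>
  define E where "E = insert (1 / (2 * C)) {hhat $ i | i. demand N (od N i) > 0}"
  define \<epsilon> where "\<epsilon> = Min E"
  have "finite E" "E \<noteq> {}" by (simp_all add: E_def)
  moreover have "e > 0" if e: "e \<in> E" for e
  proof -
    \<comment> \<open>By the fixed point equation the flow is a positive demand times a positive
      choice probability.\<close>
    have "hhat $ i > 0" if "demand N (od N i) > 0" for i
      using that choice_prob_pos[of N \<theta> "path_cost N hhat" i]
      by (subst hhat(2)) (simp add: logit_map_feasible[OF hhat(1)])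
    then show ?thesis using e \<open>C > 0\<close> by (auto simp: E_def)
  qed
  ultimately have "\<epsilon> > 0" and \<epsilon>: "\<And>e. e \<in> E \<Longrightarrow> \<epsilon> \<le> e" by (simp_all add: \<epsilon>_def)
  have "C * \<epsilon> \<le> 1 / 2" using \<epsilon>[of "1 / (2 * C)"] \<open>C > 0\<close> by (simp add: E_def field_simps)
  show ?thesis
  proof (intro exI[of _ "ball hhat \<epsilon>"] conjI ballI impI)
    fix h0 assume h0: "h0 \<in> ball hhat \<epsilon>" "feasible N h0"
    let ?h = "inexact_newton N \<theta> \<eta>tol \<nu>2 h0"
    have step: "?h (Suc k) = ?h k + ?\<delta> (?h k)" for k by (simp add: Let_def)
    \<comment> \<open>Feasibility permits the next step, the ball yields feasibility after it, and
      the geometric bound gives convergence.\<close>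
    have inv: "feasible N (?h k) \<and> norm (?h k - hhat) < \<epsilon> \<and> norm (?h k - hhat) \<le> (1 / 2) ^ k * \<epsilon>" for k
    proof (induction k)
      case 0
      then show ?case using h0 by (simp add: dist_norm norm_minus_commute)
    next
      case (Suc k)
      let ?e = "norm (?h k - hhat)"
      have "norm (?h (Suc k) - hhat) \<le> C * ?e * ?e"
        using C[of "?h k"] Suc.IH unfolding step by (simp add: power2_eq_square mult_ac)
      \<comment> \<open>One of the two error factors is bounded by \<open>\<epsilon>\<close>, so the
        quadratic bound becomes a contraction.\<close>
      also have "\<dots> \<le> (1 / 2) * ?e"
        using Suc.IH \<open>C > 0\<close> order_trans[OF mult_left_mono[of ?e \<epsilon> C] \<open>C * \<epsilon> \<le> 1 / 2\<close>]
        by (intro mult_right_mono) auto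
      finally have half: "norm (?h (Suc k) - hhat) \<le> (1 / 2) * ?e" .
      have lt: "norm (?h (Suc k) - hhat) < \<epsilon>"
        using half Suc.IH norm_ge_zero[of "?h k - hhat"] by linarith
      have "feasible N (?h (Suc k))"
        unfolding step
      proof (rule feasible_add_admissible[OF N])
        show "\<bar>(?h k + ?\<delta> (?h k) - hhat) $ i\<bar> \<le> hhat $ i" if "demand N (od N i) > 0" for i
        proof -
          have "\<bar>(?h k + ?\<delta> (?h k) - hhat) $ i\<bar> \<le> \<epsilon>"
            using component_le_norm_cart lt unfolding step by (rule order_trans[OF _ less_imp_le])
          also have "\<epsilon> \<le> hhat $ i" using that by (intro \<epsilon>) (auto simp: E_def)
          finally show ?thesis .
        qed
      qed (use adm Suc.IH in auto)
      with lt half Suc.IH show ?case by simp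
    qed
    have "(\<lambda>k. norm (?h k - hhat)) \<longlonglongrightarrow> 0"
    proof (rule tendsto_sandwich[OF _ _ tendsto_const])
      show "(\<lambda>k. (1 / 2) ^ k * \<epsilon>) \<longlonglongrightarrow> 0"
        by (intro tendsto_mult_left_zero LIMSEQ_power_zero) simp
    qed (use inv in auto)
    then show "?h \<longlonglongrightarrow> hhat" by (simp add: LIM_zero_cancel tendsto_norm_zero_iff)
    \<comment> \<open>The constant of the single-step bound serves for all steps, since every
      iterate is feasible.\<close>
    show "\<exists>C>0. \<forall>k. norm (?h (Suc k) - hhat) \<le> C * (norm (?h k - hhat))\<^sup>2"
      using C inv \<open>C > 0\<close> unfolding step by blast
  qed (use \<open>\<epsilon> > 0\<close> in auto)
qed

end
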